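(* Let $\mathbb{K}$ be a field of characteristic $0$, let $(A,\mu_0)$ be an anti-associative algebra over $\mathbb{K}$ whose multiplication is skew-symmetric ($\mu_0(x,y)=-\mu_0(y,x)$ for all $x,y\in A$), and write $xy=\mu_0(x,y)$. Let $\mu_t=\mu_0+\sum_{k\ge1}t^k\varphi_k$ be an anti-associative formal deformation of $\mu_0$, and let $\rho_1(x,y)=\varphi_1(x,y)+\varphi_1(y,x)$. Then $(A,\mu_0,\rho_1)$ is an anti-Poisson algebra, that is: 1. $(A,\rho_1)$ is a Jacobi-Jordan algebra; 2. the products $\mu_0$ and $\rho_1$ are connected by the anti-Leibniz identity $$\rho_1(xy,z)+x\,\rho_1(y,z)+\rho_1(x,z)\,y=0\qquad\text{for all }x,y,z\in A.$$
   Context: An algebra $(A,\mu)$ over $\mathbb{K}$ is a vector space with a bilinear map $\mu:A\times A\to A$; it is anti-associative if $\mu(\mu(x,y),z)+\mu(x,\mu(y,z))=0$ for all $x,y,z\in A$. An anti-associative formal deformation of $(A,\mu_0)$ is a family of bilinear maps $\varphi_i:A\times A\to A$, $i\ge0$, with $\varphi_0=\mu_0$, such that for every $k\ge1$ and all $a,b,c\in A$, $$\sum_{i+j=k,\ i,j\ge0}\varphi_i(\varphi_j(a,b),c)+\sum_{i+j=k,\ i,j\ge0}\varphi_i(a,\varphi_j(b,c))=0,$$ i.e. $\mu_t=\sum_{k\ge 0} t^k\varphi_k$ is an anti-associative multiplication over formal power series in $t$. A Jacobi-Jordan algebra is a $\mathbb{K}$-vector space with a commutative bilinear product $\bullet$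 satisfying $x\bullet(y\bullet z)+y\bullet(z\bullet x)+z\bullet(x\bullet y)=0$ for all $x,y,z$. An anti-Poisson algebra is a triple $(A,\psi,\rho)$ with $A$ a $\mathbb{K}$-vector space, $\psi$ a skew-symmetric bilinear multiplication on $A$, and $\rho$ a Jacobi-Jordan multiplication on $A$ such that $\rho(\psi(x,y),z)+\psi(x,\rho(y,z))+\psi(\rho(x,z),y)=0$ for all $x,y,z\in A$ (anti-Leibniz identity). *)

theory Defs
  imports Complex_Main
begin

text \<open>
  All algebras live on a full type \<open>'v\<close> carrying an explicit scalar multiplication by a field
  \<open>'k\<close> (the library locale \<open>vector_space\<close>), so no dimension or norm is presupposed.
\<close>

definition bilinear_mult ::
    "('k::field \<Rightarrow> 'v::ab_group_add \<Rightarrow> 'v) \<Rightarrow> ('v \<Rightarrow> 'v \<Rightarrow> 'v) \<Rightarrow> bool"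
  where "bilinear_mult scale f \<longleftrightarrow>
    (\<forall>x. Vector_Spaces.linear scale scale (\<lambda>y. f x y)) \<and>
    (\<forall>y. Vector_Spaces.linear scale scale (\<lambda>x. f x y))"

definition skew_symmetric :: "('v::ab_group_add \<Rightarrow> 'v \<Rightarrow> 'v) \<Rightarrow> bool"
  where "skew_symmetric f \<longleftrightarrow> (\<forall>x y. f x y = - f y x)"

locale nonassoc_algebra = vector_space scale
  for scale :: "'k::field \<Rightarrow> 'v::ab_group_add \<Rightarrow> 'v" +
  fixes mult :: "'v \<Rightarrow> 'v \<Rightarrow> 'v"
  assumes bilinear: "bilinear_mult scale mult"

locale anti_associative_algebra = nonassoc_algebra scale mult
  for scale :: "'k::field \<Rightarrow> 'v::ab_group_add \<Rightarrow> 'v" and mult :: "'v \<Rightarrow> 'v \<Rightarrow> 'v" +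
  assumes anti_assoc: "mult (mult x y) z + mult x (mult y z) = 0"

text \<open>
  \<open>\<phi> k\<close> is the coefficient of \<open>t^k\<close> in the deformed product, and the last axiom is the vanishing of
  the coefficient of \<open>t^k\<close> in its anti-associator; for \<open>k = 0\<close> this is \<open>anti_assoc\<close>.
\<close>

locale anti_associative_deformation = anti_associative_algebra scale \<mu>\<^sub>0
  for scale :: "'k::field \<Rightarrow> 'v::ab_group_add \<Rightarrow> 'v" and \<mu>\<^sub>0 :: "'v \<Rightarrow> 'v \<Rightarrow> 'v" +
  fixes \<phi> :: "nat \<Rightarrow> 'v \<Rightarrow> 'v \<Rightarrow> 'v"
  assumes coeff_bilinear: "bilinear_mult scale (\<phi> i)"
    and coeff_0: "\<phi> 0 = \<mu>\<^sub>0"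
    and coeff_anti_assoc: "k \<ge> 1 \<Longrightarrow>
      (\<Sum>(i, j) \<in> {(i, j). i + j = k}. \<phi> i (\<phi> j a b) c) +
      (\<Sum>(i, j) \<in> {(i, j). i + j = k}. \<phi> i a (\<phi> j b c)) = 0"

locale jacobi_jordan_algebra = nonassoc_algebra scale mult
  for scale :: "'k::field \<Rightarrow> 'v::ab_group_add \<Rightarrow> 'v" and mult :: "'v \<Rightarrow> 'v \<Rightarrow> 'v" +
  assumes commute: "mult x y = mult y x"
    and jacobi: "mult x (mult y z) + mult y (mult z x) + mult z (mult x y) = 0"

locale anti_poisson_algebra =
  skew: nonassoc_algebra scale \<psi> + jacobi_jordan: jacobi_jordan_algebra scale \<rho>
  for scale :: "'k::field \<Rightarrow> 'v::ab_group_add \<Rightarrow> 'v"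
    and \<psi> :: "'v \<Rightarrow> 'v \<Rightarrow> 'v" and \<rho> :: "'v \<Rightarrow> 'v \<Rightarrow> 'v" +
  assumes skew_symmetric: "skew_symmetric \<psi>"
    and anti_leibniz: "\<rho> (\<psi> x y) z + \<psi> x (\<rho> y z) + \<psi> (\<rho> x z) y = 0"

end

theory Submission
  imports Defs
begin

text \<open>
  Both identities are sums of permuted instances of the low order deformation equations. The
  anti-Leibniz identity is the sum of the equations of order 1 at \<open>(x, y, z)\<close>, \<open>(z, x, y)\<close> and
  \<open>(x, z, y)\<close>. For the Jacobi identity, sum the equation of order 2 over all six permutations of
  \<open>x, y, z\<close>: every term containing \<open>\<phi> 2\<close> cancels by the skew symmetry of \<open>\<mu>\<^sub>0\<close>.
\<close>

text \<open>Library linearity includes the vector space axioms, hence the conjunct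
  \<open>vector_space scale\<close>; keeping it lets \<open>bilinear_mult_symmetrize\<close>
  interpret that locale.\<close>

lemma bilinear_mult_iff:
  "bilinear_mult scale f \<longleftrightarrow> vector_space scale \<and>
    (\<forall>x y z. f x (y + z) = f x y + f x z) \<and> (\<forall>x y z. f (x + y) z = f x z + f y z) \<and>
    (\<forall>c x y. f x (scale c y) = scale c (f x y)) \<and> (\<forall>c x y. f (scale c x) y = scale c (f x y))"
  by (auto simp: bilinear_mult_def Vector_Spaces.linear_iff)

lemma bilinear_mult_symmetrize:
  assumes "bilinear_mult scale f"
  shows "bilinear_mult scale (\<lambda>x y. f x y + f y x)"
proof -
  interpret vector_space scale
    using assms by (simp add: bilinear_mult_iff)
  show ?thesis
    using assms by (simp add: bilinear_mult_iff scale_right_distrib algebra_simps)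
qed

text \<open>Additivity alone gives this. It moves the signs produced by skew symmetry out of the
  arguments of the coefficients.\<close>

lemma bilinear_mult_uminus:
  assumes "bilinear_mult scale f"
  shows "f (- x) y = - f x y" "f x (- y) = - f x y"
proof -
  have add: "f (a + b) c = f a c + f b c" "f a (b + c) = f a b + f a c" for a b c
    using assms by (simp_all add: bilinear_mult_iff)
  have zero: "f 0 y = 0" "f x 0 = 0"
    using add(1)[of 0 0 y] add(2)[of x 0 0] by simp_all
  show "f (- x) y = - f x y"
    using add(1)[of "- x" x y] zero by (simp add: eq_neg_iff_add_eq_0)
  show "f x (- y) = - f x y"
    using add(2)[of x "- y" y] zero by (simp add: eq_neg_iff_add_eq_0)
qed

context anti_associative_deformation
begin

lemma order_1:
  "\<phi> 1 (\<mu>\<^sub>0 a b) c + \<mu>\<^sub>0 (\<phi> 1 a b) c + \<phi> 1 a (\<mu>\<^sub>0 b c) + \<mu>\<^sub>0 a (\<phi> 1 b c) = 0"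
proof -
  \<comment> \<open>Listing the index pairs lets the simplifier expand both sums.\<close>
  have "{(i, j). i + j = 1} = {(0, 1), (1, 0::nat)}"
    by auto
  then show ?thesis
    using coeff_anti_assoc[of 1 a b c] by (simp add: coeff_0 algebra_simps)
qed

lemma order_2:
  "\<phi> 2 (\<mu>\<^sub>0 a b) c + \<phi> 1 (\<phi> 1 a b) c + \<mu>\<^sub>0 (\<phi> 2 a b) c +
    \<phi> 2 a (\<mu>\<^sub>0 b c) + \<phi> 1 a (\<phi> 1 b c) + \<mu>\<^sub>0 a (\<phi> 2 b c) = 0"
proof -
  have "{(i, j). i + j = 2} = {(0, 2), (1, 1), (2, 0::nat)}"
    by auto
  then show ?thesis
    using coeff_anti_assoc[of 2 a b c] by (simp add: coeff_0 algebra_simps)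
qed

lemma anti_leibniz_order_1:
  assumes "skew_symmetric \<mu>\<^sub>0"
  defines "\<rho> \<equiv> \<lambda>x y. \<phi> 1 x y + \<phi> 1 y x"
  shows "\<rho> (\<mu>\<^sub>0 x y) z + \<mu>\<^sub>0 x (\<rho> y z) + \<mu>\<^sub>0 (\<rho> x z) y = 0"
proof -
  have skew: "\<mu>\<^sub>0 a b = - \<mu>\<^sub>0 b a" for a b
    using assms(1) unfolding skew_symmetric_def by blast
  have add: "\<mu>\<^sub>0 (a + b) c = \<mu>\<^sub>0 a c + \<mu>\<^sub>0 b c" "\<mu>\<^sub>0 a (b + c) = \<mu>\<^sub>0 a b + \<mu>\<^sub>0 a c" for a b c
    using bilinear by (simp_all add: bilinear_mult_iff)
  define E where "E a b c =
    \<phi> 1 (\<mu>\<^sub>0 a b) c + \<mu>\<^sub>0 (\<phi> 1 a b) c + \<phi> 1 a (\<mu>\<^sub>0 b c) + \<mu>\<^sub>0 a (\<phi> 1 b c)" for a b c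
  \<comment> \<open>On the right, skew symmetry cancels
    \<open>\<phi> 1 x (\<mu>\<^sub>0 y z)\<close> against
    \<open>\<phi> 1 x (\<mu>\<^sub>0 z y)\<close>, \<open>\<phi> 1 (\<mu>\<^sub>0 z x) y\<close>
    against \<open>\<phi> 1 (\<mu>\<^sub>0 x z) y\<close>, and
    \<open>\<mu>\<^sub>0 (\<phi> 1 x y) z\<close> against
    \<open>\<mu>\<^sub>0 z (\<phi> 1 x y)\<close>. Only chosen instances of \<open>skew\<close> are
    unfolded, since the general equation would rewrite forever.\<close>
  have "\<rho> (\<mu>\<^sub>0 x y) z + \<mu>\<^sub>0 x (\<rho> y z) + \<mu>\<^sub>0 (\<rho> x z) y = E x y z + E z x y + E x z y"
    unfolding \<rho>_def E_def add skew[of z y] skew[of z x] skew[of z "\<phi> 1 x y"]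
      bilinear_mult_uminus[OF coeff_bilinear]
    by simp
  then show ?thesis
    using order_1 by (simp add: E_def)
qed

lemma jacobi_order_1:
  assumes "skew_symmetric \<mu>\<^sub>0"
  defines "\<rho> \<equiv> \<lambda>x y. \<phi> 1 x y + \<phi> 1 y x"
  shows "\<rho> x (\<rho> y z) + \<rho> y (\<rho> z x) + \<rho> z (\<rho> x y) = 0"
proof -
  have skew: "\<mu>\<^sub>0 a b = - \<mu>\<^sub>0 b a" for a b
    using assms(1) unfolding skew_symmetric_def by blast
  have add: "\<phi> i (a + b) c = \<phi> i a c + \<phi> i b c" "\<phi> i a (b + c) = \<phi> i a b + \<phi> i a c" for i a b c
    using coeff_bilinear[of i] by (simp_all add: bilinear_mult_iff)
  define E where "E a b c =
    \<phi> 2 (\<mu>\<^sub>0 a b) c + \<phi> 1 (\<phi> 1 a b) c + \<mu>\<^sub>0 (\<phi> 2 a b) c +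
    \<phi> 2 a (\<mu>\<^sub>0 b c) + \<phi> 1 a (\<phi> 1 b c) + \<mu>\<^sub>0 a (\<phi> 2 b c)" for a b c
  \<comment> \<open>The instances of \<open>skew\<close> put products of two variables in
    alphabetical order and values of \<open>\<phi> 2\<close> on the left, so that opposite terms
    meet. What survives is the twelve nested \<open>\<phi> 1\<close> terms, exactly the expansion of
    the left side.\<close>
  have "\<rho> x (\<rho> y z) + \<rho> y (\<rho> z x) + \<rho> z (\<rho> x y) =
      E x y z + E y z x + E z x y + E y x z + E x z y + E z y x"
    unfolding \<rho>_def E_def add
      skew[of z y] skew[of z x] skew[of y x]
      skew[of x "\<phi> 2 _ _"] skew[of y "\<phi> 2 _ _"] skew[of z "\<phi> 2 _ _"]
      bilinear_mult_uminus[OF coeff_bilinear]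
    by (simp add: algebra_simps)
  then show ?thesis
    using order_2 by (simp add: E_def)
qed

end

theorem theorem23:
  fixes scale :: "'k::field_char_0 \<Rightarrow> 'v::ab_group_add \<Rightarrow> 'v"
    and \<mu>\<^sub>0 :: "'v \<Rightarrow> 'v \<Rightarrow> 'v"
    and \<phi> :: "nat \<Rightarrow> 'v \<Rightarrow> 'v \<Rightarrow> 'v"
    and \<rho>\<^sub>1 :: "'v \<Rightarrow> 'v \<Rightarrow> 'v"
  assumes "anti_associative_algebra scale \<mu>\<^sub>0"
    and "skew_symmetric \<mu>\<^sub>0"
    and "anti_associative_deformation scale \<mu>\<^sub>0 \<phi>"
    and "\<And>x y. \<rho>\<^sub>1 x y = \<phi> 1 x y + \<phi> 1 y x"
  shows "anti_poisson_algebra scale \<mu>\<^sub>0 \<rho>\<^sub>1 \<and>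
    jacobi_jordan_algebra scale \<rho>\<^sub>1 \<and>
    (\<forall>x y z. \<rho>\<^sub>1 (\<mu>\<^sub>0 x y) z + \<mu>\<^sub>0 x (\<rho>\<^sub>1 y z) + \<mu>\<^sub>0 (\<rho>\<^sub>1 x z) y = 0)"
proof -
  interpret anti_associative_deformation scale \<mu>\<^sub>0 \<phi>
    by (fact assms(3))
  have \<rho>: "\<rho>\<^sub>1 = (\<lambda>x y. \<phi> 1 x y + \<phi> 1 y x)"
    using assms(4) by blast
  have jj: "jacobi_jordan_algebra scale \<rho>\<^sub>1"
  \<comment> \<open>The vector space axioms come from the interpretation above.\<close>
  proof unfold_locales
    show "bilinear_mult scale \<rho>\<^sub>1"
      unfolding \<rho> by (rule bilinear_mult_symmetrize[OF coeff_bilinear])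
    show "\<rho>\<^sub>1 x y = \<rho>\<^sub>1 y x" for x y
      by (simp add: \<rho> add.commute)
    show "\<rho>\<^sub>1 x (\<rho>\<^sub>1 y z) + \<rho>\<^sub>1 y (\<rho>\<^sub>1 z x) + \<rho>\<^sub>1 z (\<rho>\<^sub>1 x y) = 0" for x y z
      unfolding \<rho> by (rule jacobi_order_1[OF assms(2)])
  qed
  have leibniz: "\<rho>\<^sub>1 (\<mu>\<^sub>0 x y) z + \<mu>\<^sub>0 x (\<rho>\<^sub>1 y z) + \<mu>\<^sub>0 (\<rho>\<^sub>1 x z) y = 0" for x y z
    unfolding \<rho> by (rule anti_leibniz_order_1[OF assms(2)])
  \<comment> \<open>Here \<open>nonassoc_algebra_axioms\<close> is the interpreted fact for
    \<open>\<mu>\<^sub>0\<close>.\<close>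
  have "anti_poisson_algebra scale \<mu>\<^sub>0 \<rho>\<^sub>1"
    by (intro anti_poisson_algebra.intro anti_poisson_algebra_axioms.intro
        nonassoc_algebra_axioms jj assms(2) leibniz)
  with jj leibniz show ?thesis
    by blast
qed

end
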